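(* Let $n,m\ge 1$ be integers and let $a_{ij}\in\mathbb{R}$ ($1\le i\le n$, $1\le j\le m$) and $b_j\in\mathbb{R}$ ($1\le j\le m$). Consider the following system of linear constraints in the real variables $\lambda_1,\dots,\lambda_n,\alpha,s_1,\dots,s_m$: $$\forall j\in\{1,\dots,m\}\colon\ \sum_{i=1}^{n}a_{ij}\lambda_i-\alpha+s_j=b_j,\qquad \forall i\colon\lambda_i\ge 0,\quad \forall j\colon s_j\ge 0,\quad \alpha\ge 0.$$ For arbitrary $\lambda_1^0,\dots,\lambda_n^0>0$, let $$\delta:=\min_{j}\left\{b_j-\sum_{i=1}^{n}a_{ij}\lambda_i^0\right\}.$$ Then an interior feasible point of this system is given by setting $\lambda_i=\lambda_i^0$ for all $i$, $\alpha=1+\max\{0,-\delta\}$, and $s_j=b_j-\sum_{i=1}^{n}a_{ij}\lambda_i^0+\alpha$ for all $j$.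
   Context: An interior feasible point of a system consisting of linear equality constraints and non-negativity constraints on all variables is a point that satisfies all the equality constraints and at which all variables are strictly positive. *)

theory Defs
  imports Complex_Main
begin

text \<open>
  A system of linear equality constraints (one for every element of \<open>rows\<close>) together with
  non-negativity constraints on all variables in \<open>vars\<close>.  The types only provide names; the
  system itself is given by the carrier sets, which are meant to be finite.
\<close>

record ('c, 'v) lin_system =
  rows :: "'c set"
  vars :: "'v set"
  coeff :: "'c \<Rightarrow> 'v \<Rightarrow> real"
  rhs :: "'c \<Rightarrow> real"

definition satisfies_equalities :: "('c, 'v) lin_system \<Rightarrow> ('v \<Rightarrow> real) \<Rightarrow> bool" where
  "satisfies_equalities S x \<longleftrightarrow>
     (\<forall>c\<in>rows S. (\<Sum>v\<in>vars S. coeff S c v * x v) = rhs S c)"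

definition interior_feasible_point :: "('c, 'v) lin_system \<Rightarrow> ('v \<Rightarrow> real) \<Rightarrow> bool" where
  "interior_feasible_point S x \<longleftrightarrow> satisfies_equalities S x \<and> (\<forall>v\<in>vars S. x v > 0)"

datatype var = Lambda nat | Alpha | Slack nat

definition relaxed_system ::
  "nat \<Rightarrow> nat \<Rightarrow> (nat \<Rightarrow> nat \<Rightarrow> real) \<Rightarrow> (nat \<Rightarrow> real) \<Rightarrow> (nat, var) lin_system" where
  "relaxed_system n m a b =
     \<lparr> rows = {1..m},
       vars = Lambda ` {1..n} \<union> {Alpha} \<union> Slack ` {1..m},
       coeff = (\<lambda>j v. case v of Lambda i \<Rightarrow> a i j
                             | Alpha \<Rightarrow> - 1
                             | Slack k \<Rightarrow> (if k = j then 1 else 0)),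
       rhs = b \<rparr>"

lemma satisfies_equalities_relaxed_system:
  "satisfies_equalities (relaxed_system n m a b) x \<longleftrightarrow>
     (\<forall>j\<in>{1..m}. (\<Sum>i=1..n. a i j * x (Lambda i)) - x Alpha + x (Slack j) = b j)"
proof -
  have "(\<Sum>v\<in>vars (relaxed_system n m a b). coeff (relaxed_system n m a b) j v * x v) =
        (\<Sum>i=1..n. a i j * x (Lambda i)) - x Alpha + x (Slack j)" if "j \<in> {1..m}" for j
  proof -
    let ?f = "\<lambda>v. coeff (relaxed_system n m a b) j v * x v"
    have "sum ?f (Lambda ` {1..n} \<union> {Alpha} \<union> Slack ` {1..m}) =
          sum ?f (Lambda ` {1..n}) + ?f Alpha + sum ?f (Slack ` {1..m})"
    proof -
      have "sum ?f (Lambda ` {1..n} \<union> {Alpha}) = sum ?f (Lambda ` {1..n}) + sum ?f {Alpha}"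
        by (rule sum.union_disjoint) auto
      moreover have "sum ?f ((Lambda ` {1..n} \<union> {Alpha}) \<union> Slack ` {1..m}) =
          sum ?f (Lambda ` {1..n} \<union> {Alpha}) + sum ?f (Slack ` {1..m})"
        by (rule sum.union_disjoint) auto
      ultimately show ?thesis by simp
    qed
    moreover have "sum ?f (Lambda ` {1..n}) = (\<Sum>i=1..n. a i j * x (Lambda i))"
      by (subst sum.reindex) (auto simp: inj_on_def relaxed_system_def)
    moreover have "sum ?f (Slack ` {1..m}) = (\<Sum>k\<in>{1..m}. if k = j then x (Slack k) else 0)"
      by (subst sum.reindex, simp add: inj_on_def, rule sum.cong)
         (simp_all add: relaxed_system_def)
    moreover have "\<dots> = x (Slack j)"
      using that by simp
    moreover have "?f Alpha = - x Alpha"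
      by (simp add: relaxed_system_def)
    moreover have "vars (relaxed_system n m a b) = Lambda ` {1..n} \<union> {Alpha} \<union> Slack ` {1..m}"
      by (simp add: relaxed_system_def)
    ultimately show ?thesis
      by (simp only:)
  qed
  then show ?thesis
    unfolding satisfies_equalities_def by (simp add: relaxed_system_def)
qed

end

theory Submission
  imports Defs
begin

text \<open>
  The equality constraints hold because each slack is defined by solving its constraint for it.
  For positivity, write \<open>r\<^sub>j\<close> for the residual of constraint \<open>j\<close> at the given multipliers, so
  that \<open>s\<^sub>j = r\<^sub>j + \<alpha>\<close>.  Since \<open>\<delta>\<close> is the least residual and \<open>\<alpha> \<ge> 1 - \<delta>\<close>, every slack is
  at least \<open>1\<close>; the maximum with \<open>0\<close> in the choice of \<open>\<alpha>\<close> keeps \<open>\<alpha>\<close> itself at least \<open>1\<close> when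
  all residuals are positive.
\<close>

theorem theorem7:
  fixes n m :: nat
    and a :: "nat \<Rightarrow> nat \<Rightarrow> real"
    and b :: "nat \<Rightarrow> real"
    and l0 :: "nat \<Rightarrow> real"
    and \<delta> :: real
    and x :: "var \<Rightarrow> real"
  assumes "n \<ge> 1" and "m \<ge> 1"
    and "\<forall>i\<in>{1..n}. l0 i > 0"
    and "\<delta> = (MIN j\<in>{1..m}. b j - (\<Sum>i=1..n. a i j * l0 i))"
    and "\<forall>i\<in>{1..n}. x (Lambda i) = l0 i"
    and "x Alpha = 1 + max 0 (- \<delta>)"
    and "\<forall>j\<in>{1..m}. x (Slack j) = b j - (\<Sum>i=1..n. a i j * l0 i) + x Alpha"
  shows "interior_feasible_point (relaxed_system n m a b) x"
proof -
  have lambda_sum: "(\<Sum>i=1..n. a i j * x (Lambda i)) = (\<Sum>i=1..n. a i j * l0 i)" for j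
    using assms(5) by (intro sum.cong) auto
  have "satisfies_equalities (relaxed_system n m a b) x"
    unfolding satisfies_equalities_relaxed_system lambda_sum using assms(7) by simp
  moreover have "x (Lambda i) > 0" if "i \<in> {1..n}" for i
    using that assms(3,5) by simp
  moreover have "x Alpha > 0"
    using assms(6) by linarith
  moreover have "x (Slack j) > 0" if "j \<in> {1..m}" for j
  proof -
    have "\<delta> \<le> b j - (\<Sum>i=1..n. a i j * l0 i)"
      unfolding assms(4) using that by (intro Min_le) auto
    moreover have "x (Slack j) = b j - (\<Sum>i=1..n. a i j * l0 i) + x Alpha"
      using assms(7) that by blast
    ultimately show ?thesis
      using assms(6) by linarith
  qed
  ultimately show ?thesis
    unfolding interior_feasible_point_def by (auto simp: relaxed_system_def)
qed

end
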